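(* Order-dominance (as defined in the context) holds for each of the following pairs of rational numbers. (i) Let $A,B$ be odd positive integers. Then the pair $A,B$ is order-dominant if either $\left(\frac{-B(1-B)}{A}\right)=-1$ or $\left(\frac{1-B}{A}\right)=-1$. (ii) The pair $2,B$ is order-dominant for every odd positive integer $B$. (iii) The pair $A,2$ is order-dominant for every odd positive integer $A$ with $\left(\frac{-1}{A}\right)=-1$ or $\left(\frac{-2}{A}\right)=-1$, i.e., for all odd positive integers $A\not\equiv 1\pmod 8$. (iv) If $A,B$ are coprime positive integers with $A\ge 2$ and $B>A^4$, then the pair $-A,B$ is order-dominant.
   Context: For a prime $p$ and a rational number $\alpha$ that is a $p$-adic unit, $\mathrm{ord}_p(\alpha)$ denotes the multiplicative order of $\alpha \bmod p$ in $\mathbb{F}_p^{\times}$. For $\alpha,\beta\in\mathbb{Q}^{\times}\setminus\{\pm1\}$, the ordered pair $\alpha,\beta$ is called order-dominant if $\mathrm{ord}_p(\alpha)>\mathrm{ord}_p(\beta)$ for infinitely many primes $p$ (at which both are $p$-adic units). $\left(\frac{\cdot}{\cdot}\right)$ denotes the Legendre–Jacobi–Kronecker symbol. *)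

theory Defs
  imports "HOL-Number_Theory.Number_Theory"
begin

definition padic_unit :: "nat \<Rightarrow> rat \<Rightarrow> bool" where
  "padic_unit p \<alpha> \<longleftrightarrow>
     \<not> int p dvd fst (quotient_of \<alpha>) \<and> \<not> int p dvd snd (quotient_of \<alpha>)"

text \<open>The residue class of a \<open>p\<close>-adic unit in \<open>\<bbbF>\<^sub>p\<close>, given by its representative in \<open>{0..<p}\<close>.\<close>

definition rat_mod :: "nat \<Rightarrow> rat \<Rightarrow> nat" where
  "rat_mod p \<alpha> =
     nat ((fst (quotient_of \<alpha>) * modular_inverse (int p) (snd (quotient_of \<alpha>))) mod int p)"

definition rat_ord :: "nat \<Rightarrow> rat \<Rightarrow> nat" where
  "rat_ord p \<alpha> = ord p (rat_mod p \<alpha>)"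

text \<open>
  The notion is meant for \<open>\<alpha>, \<beta> \<in> \<rat>\<^sup>\<times> - {1, -1}\<close>, but the same condition makes sense
  for all rationals; it is not satisfied if \<open>\<alpha>\<close> or \<open>\<beta>\<close> is \<open>0\<close>.
\<close>

definition order_dominant :: "rat \<Rightarrow> rat \<Rightarrow> bool" where
  "order_dominant \<alpha> \<beta> \<longleftrightarrow>
     infinite {p. prime p \<and> padic_unit p \<alpha> \<and> padic_unit p \<beta> \<and> rat_ord p \<alpha> > rat_ord p \<beta>}"

definition kronecker_prime :: "int \<Rightarrow> int \<Rightarrow> int" where
  "kronecker_prime a p =
     (if p = 2 then (if even a then 0 else if a mod 8 \<in> {1, 7} then 1 else -1)
      else Legendre a p)"

text \<open>
  The prime factorization of an integer ignores its sign, so the unit part of \<open>n\<close>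
  is accounted for by the first factor.
\<close>

definition kronecker :: "int \<Rightarrow> int \<Rightarrow> int" where
  "kronecker a n =
     (if n = 0 then (if \<bar>a\<bar> = 1 then 1 else 0)
      else (if n < 0 \<and> a < 0 then -1 else 1) *
           (\<Prod>p\<in>#prime_factorization n. kronecker_prime a p))"

lemma rat_mod_of_int:
  assumes "prime p"
  shows "rat_mod p (of_int a) = nat (a mod int p)"
proof -
  have "1 < int p"
    using prime_gt_1_nat[OF assms] by simp
  thus ?thesis
    by (simp add: rat_mod_def)
qed

lemma kronecker_eq_Legendre:
  assumes "prime p" "p \<noteq> 2"
  shows "kronecker a p = Legendre a p"
  using assms prime_gt_0_int[of p]
  by (simp add: kronecker_def kronecker_prime_def prime_factorization_prime)

end

(*
  If p is an odd prime, (a/p) = -1 and k is even, then ord_p(a) is even, so every b with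
  a^k = b or b a^k = 1 modulo p has an order dividing ord_p(a)/2.  It therefore suffices to find
  positive odd n prime to any given M coprime to a, with (a/n) = -1 and with n dividing a^k - b
  or b a^k - 1 for an even k: some prime factor p of n has (a/p) = -1 and is not among the
  primes excluded by M.  Choosing k with a^k = 1 modulo a suitable multiple of M, and an integer
  t given by this congruence, one can take n to be
    (A^k - B)/(B - 1) = 8Mt - 1  or  (B A^k - 1)/(B - 1) = 8BMt + 1  in (i) and (iii),
    |2^(k+2) - B|/|4 - B| = |4Mt + 1| with Mt odd, so that 2 has symbol -1,  in (ii),
    (A^(k+4) - B)/(B - A^4) = A^4 L t - 1, which is -1 modulo 8A,  in (iv),
  where L is a multiple of M; Jacobi reciprocity evaluates (a/n).
*)

theory Submission
  imports Defs
begin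

subsection \<open>Reciprocity for the Kronecker symbol\<close>

lemma Legendre_values: "Legendre a p \<in> {-1, 0, 1}"
  by (auto simp: Legendre_def)

lemma Legendre_eq_0_iff: "Legendre a p = 0 \<longleftrightarrow> p dvd a"
  by (auto simp: Legendre_def cong_0_iff)

lemma Legendre_cong:
  assumes "[a = b] (mod p)"
  shows "Legendre a p = Legendre b p"
proof -
  have "[a = c] (mod p) \<longleftrightarrow> [b = c] (mod p)" "[c = a] (mod p) \<longleftrightarrow> [c = b] (mod p)" for c
    using assms by (auto simp: cong_def)
  thus ?thesis
    by (simp add: Legendre_def QuadRes_def)
qed

text \<open>Two of the values -1, 0, 1 differ by at most 2. This turns the congruences of Euler's
  criterion into equalities.\<close>

lemma eq_of_cong_of_signs:
  assumes "[x = y] (mod p)" "x \<in> {-1, 0, 1}" "y \<in> {-1, 0, 1}" "(p :: int) > 2"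
  shows "x = y"
proof -
  have "p dvd x - y"
    using assms(1) by (simp add: cong_iff_dvd_diff)
  moreover have "\<bar>x - y\<bar> < p"
    using assms(2-4) by auto
  ultimately have "x - y = 0"
    using dvd_imp_le_int[of "x - y" p] by linarith
  thus ?thesis by simp
qed

lemma euler_criterion_int:
  assumes "prime p" "(p :: int) > 2"
  shows "[Legendre a p = a ^ ((nat p - 1) div 2)] (mod p)"
proof -
  have "prime (nat p)" "2 < nat p" "int (nat p) = p"
    using assms by (simp_all add: prime_nat_iff_prime)
  thus ?thesis
    using euler_criterion[of "nat p" a] by simp
qed

lemma Legendre_mult:
  assumes "prime p" "(p :: int) > 2"
  shows "Legendre (a * b) p = Legendre a p * Legendre b p"
proof (rule eq_of_cong_of_signs)
  have "[Legendre (a * b) p = (a * b) ^ ((nat p - 1) div 2)] (mod p)"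
    by (rule euler_criterion_int[OF assms])
  also have "(a * b) ^ ((nat p - 1) div 2) = a ^ ((nat p - 1) div 2) * b ^ ((nat p - 1) div 2)"
    by (rule power_mult_distrib)
  also have "[\<dots> = Legendre a p * Legendre b p] (mod p)"
    by (intro cong_mult cong_sym[OF euler_criterion_int] assms)
  finally show "[Legendre (a * b) p = Legendre a p * Legendre b p] (mod p)" .
  show "Legendre a p * Legendre b p \<in> {-1, 0, 1}"
    using Legendre_values[of a p] Legendre_values[of b p] by auto
qed (simp_all only: Legendre_values assms)

lemma Legendre_minus_one:
  assumes "prime p" "(p :: int) > 2"
  shows "Legendre (-1) p = (if p mod 4 = 3 then -1 else 1)"
proof (rule eq_of_cong_of_signs)
  have odd: "odd p"
    using assms prime_odd_int by auto
  have "(nat p - 1) div 2 = nat ((p - 1) div 2)"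
    using assms(2) by simp
  moreover have "even ((p - 1) div 2) \<longleftrightarrow> p mod 4 \<noteq> 3"
    using odd by presburger
  ultimately have "even ((nat p - 1) div 2) \<longleftrightarrow> p mod 4 \<noteq> 3"
    using assms(2) by (simp add: even_nat_iff)
  hence "(-1) ^ ((nat p - 1) div 2) = (if p mod 4 = 3 then -1 else (1 :: int))"
    by (simp add: uminus_power_if)
  with euler_criterion_int[OF assms, of "-1"]
  show "[Legendre (-1) p = (if p mod 4 = 3 then -1 else 1)] (mod p)"
    by simp
qed (simp_all only: Legendre_values assms, simp)

text \<open>With one symbol on each side, instead of their product, the law also covers
  \<open>p = q\<close>, where both symbols vanish.\<close>

lemma Legendre_reciprocity:
  assumes "prime p" "prime q" "odd p" "odd (q :: int)"
  shows "Legendre p q = (if p mod 4 = 3 \<and> q mod 4 = 3 then -1 else 1) * Legendre q p"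
proof (cases "p = q")
  case True
  thus ?thesis
    by (simp add: Legendre_eq_0_iff Legendre_def cong_0_iff)
next
  case False
  have gt: "p > 2" "q > 2"
    using assms prime_ge_2_int[of p] prime_ge_2_int[of q] by (auto simp: less_le)
  have ndvd: "\<not> p dvd q" "\<not> q dvd p"
    using False assms primes_dvd_imp_eq by blast+
  let ?e = "nat ((p - 1) div 2 * ((q - 1) div 2))"
  have prod: "Legendre p q * Legendre q p = (-1 :: int) ^ ?e"
    using gt False assms(1,2) by (intro Quadratic_Reciprocity_int) (simp_all add: prime_nat_iff_prime)
  have "even ?e \<longleftrightarrow> even ((p - 1) div 2) \<or> even ((q - 1) div 2)"
    using gt by (subst even_nat_iff) auto
  also have "even ((p - 1) div 2) \<longleftrightarrow> p mod 4 \<noteq> 3"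
    using assms(3) by presburger
  also have "even ((q - 1) div 2) \<longleftrightarrow> q mod 4 \<noteq> 3"
    using assms(4) by presburger
  finally have "Legendre p q * Legendre q p = (if p mod 4 = 3 \<and> q mod 4 = 3 then -1 else 1)"
    unfolding prod by (auto simp only: uminus_power_if power_one split: if_splits)
  moreover have "Legendre p q \<in> {-1, 1}" "Legendre q p \<in> {-1, 1}"
    using Legendre_values[of p q] Legendre_values[of q p] ndvd
    by (auto simp: Legendre_eq_0_iff)
  ultimately show ?thesis
    by (auto split: if_splits)
qed

text \<open>The Kronecker symbol is a product over the prime factors of its lower argument, so its
  laws follow from those of the Legendre symbol by splitting off one odd prime at a time.\<close>

lemma odd_pos_prime_induct [consumes 2, case_names one prime_mult]:
  fixes n :: int
  assumes "odd n" "n > 0" "P 1"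
    and step: "\<And>p m. \<lbrakk>prime p; odd p; p > 2; odd m; m > 0; P m\<rbrakk> \<Longrightarrow> P (p * m)"
  shows "P n"
proof -
  have "odd n \<longrightarrow> n > 0 \<longrightarrow> P n"
  proof (induction n rule: prime_divisors_induct)
    case (unit x)
    thus ?case using assms(3) by auto
  next
    case (factor p x)
    show ?case
    proof (intro impI)
      assume "odd (p * x)" "p * x > 0"
      moreover from this have "p > 2"
        using prime_ge_2_int[OF factor(1)] by (auto simp: less_le)
      ultimately show "P (p * x)"
        using factor by (intro step) (auto simp: zero_less_mult_iff)
    qed
  qed auto
  thus ?thesis using assms by blast
qed

section \<open>Kronecker symbol: multiplicativity, periodicity and zeros\<close>

lemma kronecker_one_right [simp]: "kronecker a 1 = 1"
  by (simp add: kronecker_def)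

lemma kronecker_mult_right:
  assumes "m > 0" "n > 0"
  shows "kronecker a (m * n) = kronecker a m * kronecker a n"
proof -
  have "\<not> m * n < 0"
    using assms by (simp add: not_less)
  with assms show ?thesis
    by (simp add: kronecker_def prime_factorization_mult)
qed

lemma kronecker_odd_prime_mult:
  assumes "prime p" "p > 2" "m > 0"
  shows "kronecker a (p * m) = Legendre a p * kronecker a m"
proof -
  have "kronecker a p = Legendre a p"
    using assms kronecker_eq_Legendre[of "p" a] 
    by (simp add: kronecker_def kronecker_prime_def prime_factorization_prime)
  thus ?thesis
    using assms by (simp add: kronecker_mult_right)
qed

lemma kronecker_mult_left:
  assumes "odd n" "n > 0"
  shows "kronecker (a * b) n = kronecker a n * kronecker b n"
  using assms
proof (induction n rule: odd_pos_prime_induct)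
  case (prime_mult p m)
  thus ?case by (simp add: kronecker_odd_prime_mult Legendre_mult)
qed simp

lemma kronecker_cong:
  assumes "odd n" "n > 0" "[a = b] (mod n)"
  shows "kronecker a n = kronecker b n"
  using assms
proof (induction n rule: odd_pos_prime_induct)
  case (prime_mult p m)
  hence "[a = b] (mod p)" "[a = b] (mod m)"
    by (auto intro: cong_dvd_modulus)
  with prime_mult show ?case
    by (simp add: kronecker_odd_prime_mult Legendre_cong[of a b])
qed simp

lemma kronecker_eq_0_iff:
  assumes "odd n" "n > 0"
  shows "kronecker a n = 0 \<longleftrightarrow> \<not> coprime a n"
  using assms
proof (induction n rule: odd_pos_prime_induct)
  case (prime_mult p m)
  have "coprime a p \<longleftrightarrow> \<not> p dvd a"
    using prime_mult(1) by (metis coprime_commute prime_imp_coprime coprime_absorb_left not_prime_unit)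
  with prime_mult show ?case
    by (auto simp: kronecker_odd_prime_mult Legendre_eq_0_iff)
qed simp

lemma kronecker_values:
  assumes "odd n" "n > 0"
  shows "kronecker a n \<in> {-1, 0, 1}"
  using assms
proof (induction n rule: odd_pos_prime_induct)
  case (prime_mult p m)
  with Legendre_values[of a p] show ?case
    by (auto simp: kronecker_odd_prime_mult)
qed simp

text \<open>The value is idempotent, as 1 * 1 = 1, and nonzero, as 1 is coprime to
  \<open>n\<close>.\<close>

lemma kronecker_one_left:
  assumes "odd n" "n > 0"
  shows "kronecker 1 n = 1"
  using kronecker_mult_left[OF assms, of 1 1] kronecker_eq_0_iff[OF assms, of 1] by simp

section \<open>Quadratic reciprocity and the supplementary laws for odd positive integers\<close>

lemma odd_mult_mod_4_eq_3_iff: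
  assumes "odd a" "odd (b :: int)"
  shows "a * b mod 4 = 3 \<longleftrightarrow> (a mod 4 = 3) \<noteq> (b mod 4 = 3)"
proof -
  have "a mod 4 = 1 \<or> a mod 4 = 3" "b mod 4 = 1 \<or> b mod 4 = 3"
    using assms by presburger+
  thus ?thesis
    by (subst mod_mult_eq [symmetric]) auto
qed

lemma kronecker_minus_one:
  assumes "odd n" "n > 0"
  shows "kronecker (-1) n = (if n mod 4 = 3 then -1 else 1)"
  using assms
proof (induction n rule: odd_pos_prime_induct)
  case (prime_mult p m)
  have "p * m mod 4 = 3 \<longleftrightarrow> (p mod 4 = 3) \<noteq> (m mod 4 = 3)"
    using prime_mult by (simp add: odd_mult_mod_4_eq_3_iff)
  with prime_mult show ?case
    by (auto simp: kronecker_odd_prime_mult Legendre_minus_one)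
qed simp

text \<open>The sign is multiplicative in \<open>n\<close>, so the law passes from prime
  \<open>n\<close> to composite \<open>n\<close>. A second induction, on the other argument, then
  gives the general law.\<close>

lemma kronecker_reciprocity_prime:
  assumes "odd n" "n > 0" "prime p" "odd p" "p > 2"
  shows "Legendre n p = (if n mod 4 = 3 \<and> p mod 4 = 3 then -1 else 1) * kronecker p n"
  using assms
proof (induction n rule: odd_pos_prime_induct)
  case one
  thus ?case
    using kronecker_one_left[of p] kronecker_odd_prime_mult[of p 1 1] by simp
next
  case (prime_mult q m)
  have "q * m mod 4 = 3 \<longleftrightarrow> (q mod 4 = 3) \<noteq> (m mod 4 = 3)"
    using prime_mult by (simp add: odd_mult_mod_4_eq_3_iff)
  with prime_mult show ?case
    by (auto simp: kronecker_odd_prime_mult Legendre_mult Legendre_reciprocity[of q p])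
qed

theorem kronecker_reciprocity:
  assumes "odd m" "m > 0" "odd n" "n > 0"
  shows "kronecker m n = (if m mod 4 = 3 \<and> n mod 4 = 3 then -1 else 1) * kronecker n m"
  using assms(3,4)
proof (induction n rule: odd_pos_prime_induct)
  case one
  thus ?case using assms by (simp add: kronecker_one_left)
next
  case (prime_mult p k)
  have "p * k mod 4 = 3 \<longleftrightarrow> (p mod 4 = 3) \<noteq> (k mod 4 = 3)"
    using prime_mult by (simp add: odd_mult_mod_4_eq_3_iff)
  with prime_mult assms show ?case
    by (auto simp: kronecker_odd_prime_mult kronecker_mult_left kronecker_reciprocity_prime[of m p])
qed

text \<open>
  Reciprocity for the pair \<open>n, n - 2\<close>, of which one is \<open>1\<close> modulo \<open>4\<close>, gives
  \<open>(2/n) = (-1/n) (n-2/n) = (-1/n) (2/n-2)\<close>.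
\<close>

lemma kronecker_two:
  assumes "odd n" "n > 0"
  shows "kronecker 2 n = (if n mod 8 = 1 \<or> n mod 8 = 7 then 1 else -1)"
proof -
  have "kronecker 2 (2 * int k + 1) =
      (if (2 * int k + 1) mod 8 = 1 \<or> (2 * int k + 1) mod 8 = 7 then 1 else -1)" for k
  proof (induction k)
    case (Suc k)
    define m where "m = 2 * int k + 1"
    have m: "odd m" "m > 0" "2 * int (Suc k) + 1 = m + 2"
      by (simp_all add: m_def)
    have "kronecker 2 (m + 2) = kronecker (-1 * m) (m + 2)"
      using m by (intro kronecker_cong) (auto simp: cong_iff_dvd_diff)
    also have "\<dots> = kronecker (-1) (m + 2) * kronecker m (m + 2)"
      using m by (intro kronecker_mult_left) auto
    also have "kronecker m (m + 2) = kronecker (m + 2) m"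
    proof -
      have "\<not> (m mod 4 = 3 \<and> (m + 2) mod 4 = 3)"
        by presburger
      thus ?thesis
        using m by (subst kronecker_reciprocity) auto
    qed
    also have "kronecker (m + 2) m = kronecker 2 m"
      using m by (intro kronecker_cong) (auto simp: cong_iff_dvd_diff)
    finally have "kronecker 2 (m + 2) = (if (m + 2) mod 4 = 3 then -1 else 1) * kronecker 2 m"
      using m by (simp add: kronecker_minus_one)
    \<comment> \<open>Going from \<open>m\<close> to \<open>m + 2\<close> changes membership in the
      classes 1, 7 modulo 8 exactly when the factor just found is -1.\<close>
    moreover have "(m + 2) mod 8 = 1 \<or> (m + 2) mod 8 = 7 \<longleftrightarrow>
        ((m + 2) mod 4 = 3) \<noteq> (m mod 8 = 1 \<or> m mod 8 = 7)"
    proof -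
      have "m mod 8 = 1 \<or> m mod 8 = 3 \<or> m mod 8 = 5 \<or> m mod 8 = 7"
        using \<open>odd m\<close> by presburger
      moreover have "(m + 2) mod 8 = (r + 2) mod 8 \<and> (m + 2) mod 4 = (r + 2) mod 4"
        if "m mod 8 = r" for r
      proof
        show "(m + 2) mod 8 = (r + 2) mod 8"
          using that by (simp only: mod_add_left_eq flip: that)
        have "m mod 4 = r mod 4"
          by (simp add: mod_mod_cancel flip: that)
        thus "(m + 2) mod 4 = (r + 2) mod 4"
          by (rule mod_add_cong) simp
      qed
      ultimately show ?thesis
        by auto
    qed
    moreover have "kronecker 2 m = (if m mod 8 = 1 \<or> m mod 8 = 7 then 1 else -1)"
      using Suc by (simp only: m_def)
    ultimately show ?case
      unfolding m(3) by (simp only: split: if_split) auto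
  qed (simp add: kronecker_one_left)
  moreover have "n = 2 * int (nat ((n - 1) div 2)) + 1"
    using assms by simp
  ultimately show ?thesis
    by metis
qed

lemma kronecker_square_eq_one:
  assumes "odd n" "n > 0" "coprime a n"
  shows "kronecker a n * kronecker a n = 1"
  using kronecker_values[OF assms(1,2), of a] kronecker_eq_0_iff[OF assms(1,2), of a] assms(3)
  by auto

text \<open>Factors 2 of \<open>a\<close> contribute 1, since \<open>n\<close> is 7 modulo 8. For
  odd \<open>a\<close>, reciprocity gives (a/n) = (-1/a)(n/a), which is the square of
  (-1/a).\<close>

lemma kronecker_eq_one_of_cong_minus_one:
  assumes "a > 0" "n > 0" "[n = -1] (mod 8 * a)"
  shows "kronecker a n = 1"
  using assms
proof (induction "nat a" arbitrary: a rule: less_induct)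
  case less
  have "8 dvd n + 1"
    using less.prems(3) by (auto simp: cong_iff_dvd_diff elim: dvd_mult_left)
  hence n: "odd n" "n mod 8 = 7" "n mod 4 = 3"
    by presburger+
  show ?case
  proof (cases "even a")
    case True
    then obtain b where b: "a = 2 * b" by blast
    have "[n = -1] (mod 8 * b)"
      using less.prems(3) by (rule cong_dvd_modulus) (simp add: b)
    hence "kronecker b n = 1"
      using less.prems b by (intro less.hyps) auto
    thus ?thesis
      using n less.prems by (simp add: b kronecker_mult_left kronecker_two)
  next
    case False
    have "kronecker a n = kronecker (-1) a * kronecker n a"
      using kronecker_reciprocity[of a n] n False less.prems by (simp add: kronecker_minus_one)
    also have "kronecker n a = kronecker (-1) a"
      using less.prems False by (intro kronecker_cong) (auto intro: cong_dvd_modulus)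
    finally show ?thesis
      using kronecker_square_eq_one[of a "-1"] False less.prems by simp
  qed
qed

text \<open>A product of factors from -1, 0, 1 can be -1 only if some factor is -1.\<close>

lemma prime_divisor_Legendre_minus_one:
  assumes "odd n" "n > 0" "kronecker a n = -1"
  obtains p where "prime p" "odd p" "p dvd n" "Legendre a p = -1"
proof -
  from assms have "\<exists>p. prime p \<and> odd p \<and> p dvd n \<and> Legendre a p = -1"
  proof (induction n rule: odd_pos_prime_induct)
    case (prime_mult p m)
    have "Legendre a p = -1 \<or> kronecker a m = -1"
      using prime_mult Legendre_values[of a p] kronecker_values[of m a]
      by (auto simp: kronecker_odd_prime_mult)
    with prime_mult show ?case
      by (meson dvd_mult dvd_triv_left)
  qed simp
  with that show ?thesis by blast
qed

subsection \<open>Order dominance from nonresidues\<close>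

lemma ord_nat_mod_dvd_iff:
  assumes "p > 0"
  shows "ord p (nat (a mod int p)) dvd e \<longleftrightarrow> [a ^ e = 1] (mod int p)"
proof -
  have "ord p (nat (a mod int p)) dvd e \<longleftrightarrow> [nat (a mod int p) ^ e = 1] (mod p)"
    by (simp only: ord_divides)
  also have "\<dots> \<longleftrightarrow> [(a mod int p) ^ e = 1] (mod int p)"
    using assms by (simp flip: cong_int_iff)
  also have "\<dots> \<longleftrightarrow> [a ^ e = 1] (mod int p)"
    by (simp add: cong_def power_mod)
  finally show ?thesis .
qed

lemma coprime_nat_mod_iff:
  assumes "prime p"
  shows "coprime p (nat (a mod int p)) \<longleftrightarrow> \<not> int p dvd a"
proof -
  have p: "p > 0" using assms prime_gt_0_nat by blast
  have "coprime p (nat (a mod int p)) \<longleftrightarrow> \<not> p dvd nat (a mod int p)"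
    using assms by (meson coprime_absorb_left not_prime_unit prime_imp_coprime)
  also have "p dvd nat (a mod int p) \<longleftrightarrow> int p dvd a"
    using p by (simp add: int_dvd_int_iff [symmetric] dvd_mod_iff)
  finally show ?thesis .
qed

text \<open>
  An odd order \<open>d\<close> would make \<open>a = a\<^bsup>d+1\<^esup>\<close> a square.
\<close>

lemma even_ord_of_nonresidue:
  assumes "p > 0" "Legendre a (int p) = -1"
  shows "even (ord p (nat (a mod int p)))" (is "even ?d")
proof (rule ccontr)
  assume "odd ?d"
  then obtain e where e: "?d = 2 * e + 1" by (blast elim: oddE)
  have "[a ^ ?d = 1] (mod int p)"
    using ord_nat_mod_dvd_iff[OF assms(1), of a ?d] by simp
  hence "[a ^ ?d * a = 1 * a] (mod int p)"
    by (rule cong_mult) simp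
  hence "[(a ^ (e + 1)) ^ 2 = a] (mod int p)"
    by (simp add: e power_add power2_eq_square power_mult mult_ac)
  hence "QuadRes (int p) a"
    unfolding QuadRes_def by blast
  with assms(2) show False
    by (simp add: Legendre_def split: if_splits)
qed

text \<open>An even power of \<open>a\<close> has order dividing half of the even order of
  \<open>a\<close>, and \<open>b\<close> is such a power or the inverse of one.\<close>

lemma ord_less_of_nonresidue:
  assumes "prime p" "Legendre a (int p) = -1" "even k"
    and "[a ^ k = b] (mod int p) \<or> [b * a ^ k = 1] (mod int p)"
  shows "ord p (nat (b mod int p)) < ord p (nat (a mod int p))"
proof -
  have p: "p > 0" using assms(1) prime_gt_0_nat by blast
  define d where "d = ord p (nat (a mod int p))"
  have "\<not> int p dvd a"
    using assms(2) Legendre_eq_0_iff[of a "int p"] by auto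
  hence "d > 0"
    using coprime_nat_mod_iff[OF assms(1), of a] by (simp add: d_def)
  obtain e where e: "d = 2 * e"
    using even_ord_of_nonresidue[OF p assms(2)] unfolding d_def by blast
  obtain l where l: "k = 2 * l"
    using assms(3) by blast
  have "[a ^ d = 1] (mod int p)"
    using ord_nat_mod_dvd_iff[OF p, of a d] by (simp add: d_def)
  \<comment> \<open>With \<open>d = 2 * e\<close> and \<open>k = 2 * l\<close>, both
    \<open>(a ^ d) ^ l\<close> and \<open>(a ^ k) ^ e\<close> are
    \<open>a ^ (2 * e * l)\<close>.\<close>
  hence "[(a ^ d) ^ l = 1 ^ l] (mod int p)"
    by (rule cong_pow)
  hence ak: "[(a ^ k) ^ e = 1] (mod int p)"
    by (simp add: e l mult_ac flip: power_mult)
  from assms(4) have "[b ^ e = 1] (mod int p)"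
  proof
    assume "[a ^ k = b] (mod int p)"
    hence "[(a ^ k) ^ e = b ^ e] (mod int p)"
      by (rule cong_pow)
    with ak show ?thesis
      by (metis cong_sym cong_trans)
  next
    assume "[b * a ^ k = 1] (mod int p)"
    hence "[(b * a ^ k) ^ e = 1 ^ e] (mod int p)"
      by (rule cong_pow)
    moreover have "[b ^ e * (a ^ k) ^ e = b ^ e * 1] (mod int p)"
      by (intro cong_mult ak) simp
    ultimately show ?thesis
      by (metis cong_sym cong_trans mult.right_neutral power_mult_distrib power_one)
  qed
  hence "ord p (nat (b mod int p)) dvd e"
    using ord_nat_mod_dvd_iff[OF p] by simp
  moreover have "e > 0"
    using \<open>d > 0\<close> e by simp
  ultimately have "ord p (nat (b mod int p)) \<le> e"
    by (simp add: dvd_imp_le)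
  thus ?thesis
    using e \<open>e > 0\<close> by (simp add: d_def [symmetric])
qed

lemma order_dominant_of_intI:
  assumes "\<And>N. \<exists>p>N. prime p \<and> \<not> int p dvd a \<and> \<not> int p dvd b \<and>
      ord p (nat (b mod int p)) < ord p (nat (a mod int p))"
  shows "order_dominant (of_int a) (of_int b)"
  unfolding order_dominant_def infinite_nat_iff_unbounded
proof
  fix N
  obtain p where p: "p > N" "prime p" "\<not> int p dvd a" "\<not> int p dvd b"
      "ord p (nat (b mod int p)) < ord p (nat (a mod int p))"
    using assms by blast
  \<comment> \<open>An integer has denominator 1, so this is the denominator condition in
    \<open>padic_unit\<close>.\<close>
  moreover from p have "\<not> int p dvd 1"
    using prime_gt_1_nat[of p] by auto
  ultimately show "\<exists>p>N. p \<in> {p. prime p \<and> padic_unit p (of_int a) \<and> padic_unit p (of_int b) \<and>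
      rat_ord p (of_int b) < rat_ord p (of_int a)}"
    by (intro exI[of _ p]) (simp add: padic_unit_def rat_ord_def rat_mod_of_int)
qed

text \<open>
  A prime factor of \<open>n\<close> modulo which \<open>a\<close> is a nonresidue is larger than \<open>N\<close> if \<open>n\<close> is prime to
  the product \<open>M\<close> of the primes up to \<open>N\<close> that do not divide \<open>a\<close>.
\<close>

lemma order_dominantI:
  assumes "\<And>M. \<lbrakk>M > 0; coprime a M\<rbrakk> \<Longrightarrow>
    \<exists>k n. even k \<and> odd n \<and> n > 0 \<and> coprime n M \<and> kronecker a n = -1 \<and>
      ([a ^ k = b] (mod n) \<or> [b * a ^ k = 1] (mod n))"
  shows "order_dominant (of_int a) (of_int b)"
proof (rule order_dominant_of_intI)
  fix N :: nat
  define P where "P = {p :: nat. prime p \<and> p \<le> N \<and> \<not> int p dvd a}"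
  define M where "M = (\<Prod>p\<in>P. int p)"
  have fin: "finite P"
    by (rule finite_subset[of _ "{..N}"]) (auto simp: P_def)
  have "M > 0"
    unfolding M_def by (rule prod_pos) (auto simp: P_def prime_gt_0_nat)
  moreover have "coprime a M"
    unfolding M_def
  proof (rule prod_coprime_right)
    fix p assume "p \<in> P"
    thus "coprime a (int p)"
      using prime_imp_coprime[of "int p" a] by (simp add: P_def coprime_commute)
  qed
  ultimately obtain k n where kn: "even k" "odd n" "n > 0" "coprime n M" "kronecker a n = -1"
      "[a ^ k = b] (mod n) \<or> [b * a ^ k = 1] (mod n)"
    using assms by blast
  obtain q where q: "prime q" "odd q" "q dvd n" "Legendre a q = -1"
    using prime_divisor_Legendre_minus_one[OF kn(2,3,5)] .
  define p where "p = nat q"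
  have p: "prime p" "int p = q"
    using q(1) prime_gt_0_int[of q] by (simp_all add: p_def prime_nat_iff_prime)
  have nda: "\<not> q dvd a"
    using q(4) Legendre_eq_0_iff[of a q] by auto
  have cong: "[a ^ k = b] (mod q) \<or> [b * a ^ k = 1] (mod q)"
    using kn(6) q(3) cong_dvd_modulus by blast
  \<comment> \<open>Either congruence makes \<open>b\<close> a unit modulo \<open>q\<close>; hence
    \<open>P\<close> has to leave out only the prime divisors of \<open>a\<close>.\<close>
  have "\<not> q dvd b"
    using cong
  proof
    assume "[a ^ k = b] (mod q)"
    hence "q dvd b \<longleftrightarrow> q dvd a ^ k"
      by (simp add: cong_dvd_iff)
    thus ?thesis
      using nda q(1) prime_dvd_power by blast
  next
    assume "[b * a ^ k = 1] (mod q)"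
    hence "q dvd b * a ^ k \<longleftrightarrow> q dvd 1"
      by (simp add: cong_dvd_iff)
    thus ?thesis
      using q(1) by (meson dvd_mult2 not_prime_unit)
  qed
  moreover have "p > N"
  proof (rule ccontr)
    assume "\<not> p > N"
    hence "p \<in> P"
      using p nda by (simp add: P_def)
    hence "q dvd M"
      using fin p(2) unfolding M_def by (metis dvd_prodI)
    with q(1,3) kn(4) show False
      by (meson coprime_common_divisor not_prime_unit)
  qed
  ultimately show "\<exists>p>N. prime p \<and> \<not> int p dvd a \<and> \<not> int p dvd b \<and>
      ord p (nat (b mod int p)) < ord p (nat (a mod int p))"
    using ord_less_of_nonresidue[of p a k b] p nda q(4) kn(1) cong by auto
qed

section \<open>Explicit moduli for the four families of pairs\<close>

lemma even_power_cong_one: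
  assumes "a \<ge> 2" "coprime a m" "m > (0 :: int)"
  obtains k where "even k" "k > 0" "a ^ k > C" "[a ^ k = 1] (mod m)"
proof
  \<comment> \<open>The totient serves Euler's theorem, the 2 makes \<open>k\<close> even, and the
    last factor forces \<open>k > C\<close>, whence
    \<open>a ^ k \<ge> 2 ^ k > k > C\<close>.\<close>
  define k where "k = 2 * totient (nat m) * Suc (nat C)"
  have t: "totient (nat m) > 0"
    using assms(3) by simp
  show "even k" "k > 0"
    using t by (simp_all add: k_def)
  have "C \<le> int (nat C)"
    by simp
  also have "nat C < k"
  proof -
    have "1 \<le> 2 * totient (nat m)"
      using t by linarith
    hence "1 * Suc (nat C) \<le> k"
      unfolding k_def by (rule mult_le_mono1)
    thus ?thesis by simp
  qed
  also have "int k < 2 ^ k"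
    by (metis less_exp of_nat_less_numeral_power_cancel_iff)
  also have "2 ^ k \<le> a ^ k"
    using assms(1) by (intro power_mono) auto
  finally show "a ^ k > C"
    by simp
  have "coprime (nat a) (nat m)"
    using assms by (simp flip: coprime_int_iff)
  hence "[nat a ^ totient (nat m) = 1] (mod nat m)"
    by (rule euler_theorem)
  hence "[a ^ totient (nat m) = 1] (mod m)"
    using assms by (simp flip: cong_int_iff)
  hence "[(a ^ totient (nat m)) ^ (2 * Suc (nat C)) = 1 ^ (2 * Suc (nat C))] (mod m)"
    by (rule cong_pow)
  thus "[a ^ k = 1] (mod m)"
    by (simp only: k_def mult_ac power_one flip: power_mult)
qed


text \<open>Every \<open>n\<close> constructed below is 1 or -1 modulo \<open>M\<close>; the unit
  \<open>u\<close> covers both.\<close>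

lemma coprime_of_dvd_diff_unit:
  fixes n m u :: int
  assumes "m dvd n - u" "is_unit u"
  shows "coprime n m"
proof (rule coprimeI)
  fix c assume "c dvd n" "c dvd m"
  hence "c dvd n - (n - u)"
    using assms(1) by (meson dvd_diff dvd_trans)
  hence "c dvd u"
    by simp
  thus "is_unit c"
    using assms(2) dvd_trans by blast
qed

text \<open>Even \<open>B\<close> is allowed because \<open>B = 2\<close> yields the pairs
  \<open>A, 2\<close>: the two symbols are then \<open>kronecker 2 A\<close> and
  \<open>kronecker (-1) A\<close>.\<close>

lemma order_dominant_odd:
  assumes A: "odd A" "A > 0" and B: "B \<ge> 2"
    and symb: "kronecker (- B * (1 - B)) A = -1 \<or> kronecker (1 - B) A = -1"
  shows "order_dominant (of_int A) (of_int B)"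
proof (rule order_dominantI)
  fix M :: int
  assume M: "M > 0" "coprime A M"
  have "A \<noteq> 1"
    using symb by auto
  hence A2: "A \<ge> 2"
    using A by simp
  \<comment> \<open>If this symbol were 0, so would be both symbols in \<open>symb\<close>. The
    coprimality it gives lets Euler's theorem be used modulo \<open>B - 1\<close>.\<close>
  have "kronecker (1 - B) A \<noteq> 0"
    using symb kronecker_mult_left[OF A, of "- B" "1 - B"] by auto
  hence copr: "coprime (B - 1) A"
    using kronecker_eq_0_iff[OF A, of "1 - B"] by (metis coprime_minus_left_iff minus_diff_eq)
  have "coprime A 8"
    using A(1) coprime_power_right_iff[of A 2 3] by simp
  with M copr have "coprime A (8 * (B - 1) * M)"
    by (metis coprime_commute coprime_mult_right_iff)
  moreover have "8 * (B - 1) * M > 0"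
    using M(1) B by simp
  \<comment> \<open>In this modulus \<open>B - 1\<close> makes the quotient \<open>n\<close>
    integral, \<open>M\<close> makes \<open>n\<close> coprime to \<open>M\<close>, and 8 fixes
    \<open>n\<close> modulo 4.\<close>
  ultimately obtain k where k: "even k" "k > 0" "A ^ k > 1" "[A ^ k = 1] (mod 8 * (B - 1) * M)"
    using even_power_cong_one[OF A2, of "8 * (B - 1) * M" 1] by blast
  from k(4) obtain t where "A ^ k - 1 = 8 * (B - 1) * M * t"
    unfolding cong_iff_dvd_diff ..
  hence t: "A ^ k = 1 + 8 * (B - 1) * M * t"
    by linarith
  have "8 * (B - 1) * M * t > 0"
    using k(3) t by simp
  hence "M * t > 0"
    using B by (simp add: zero_less_mult_iff mult.assoc)
  then obtain s where s: "M * t = s" "s > 0"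
    by blast
  have "A dvd A ^ k"
    using k(2) by (simp add: dvd_power)
  from symb show "\<exists>k n. even k \<and> odd n \<and> n > 0 \<and> coprime n M \<and> kronecker A n = -1 \<and>
      ([A ^ k = B] (mod n) \<or> [B * A ^ k = 1] (mod n))"
  proof
    assume symb: "kronecker (- B * (1 - B)) A = -1"
    define n where "n = 8 * (M * t) - 1"
    have n: "odd n" "n > 0" "n mod 4 = 3"
      using s(2) unfolding n_def s(1) by presburger+
    have eq: "(B - 1) * n = A ^ k - B"
      by (simp add: t n_def algebra_simps)
    have "coprime n M"
      by (rule coprime_of_dvd_diff_unit[of _ _ "-1"]) (simp_all add: n_def)
    moreover have "kronecker A n = -1"
    proof -
      have "kronecker A n = kronecker (-1) A * kronecker n A"
        using kronecker_reciprocity[of A n] n A by (simp add: kronecker_minus_one)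
      also have "\<dots> = kronecker (- n) A"
        using kronecker_mult_left[OF A, of "-1" n] by simp
      \<comment> \<open>Inserting a square equal to 1 produces the multiple
        \<open>(B - 1) * n\<close>, which is \<open>- B\<close> modulo \<open>A\<close>.\<close>
      also have "\<dots> = kronecker (B - 1) A * kronecker (B - 1) A * kronecker (- n) A"
        using kronecker_square_eq_one[OF A copr] by simp
      also have "\<dots> = kronecker (B - 1) A * kronecker ((B - 1) * - n) A"
        by (simp only: kronecker_mult_left[OF A] mult.assoc)
      also have "kronecker ((B - 1) * - n) A = kronecker B A"
        using A \<open>A dvd A ^ k\<close> eq by (intro kronecker_cong) (simp_all add: cong_iff_dvd_diff)
      also have "kronecker (B - 1) A * kronecker B A = kronecker (- B * (1 - B)) A"
        by (simp add: algebra_simps flip: kronecker_mult_left[OF A])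
      finally show ?thesis
        using symb by simp
    qed
    moreover have "[A ^ k = B] (mod n)"
      unfolding cong_iff_dvd_diff eq [symmetric] by simp
    ultimately show ?thesis
      using k(1) n by blast
  next
    assume symb: "kronecker (1 - B) A = -1"
    \<comment> \<open>This \<open>n\<close> is 1 modulo 4, so reciprocity brings no sign, and
      \<open>(1 - B) * n\<close> is 1 modulo \<open>A\<close>.\<close>
    define n where "n = 8 * (B * (M * t)) + 1"
    obtain u where u: "B * (M * t) = u" "u > 0"
      using s B by simp
    hence n: "odd n" "n > 0" "n mod 4 = 1"
      unfolding n_def u(1) by presburger+
    have eq: "(B - 1) * n = B * A ^ k - 1"
      by (simp add: t n_def algebra_simps)
    have "coprime n M"
      by (rule coprime_of_dvd_diff_unit[of _ _ 1]) (simp_all add: n_def)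
    moreover have "kronecker A n = -1"
    proof -
      have "kronecker A n = kronecker n A"
        using kronecker_reciprocity[of A n] n A by simp
      also have "\<dots> = kronecker (1 - B) A * kronecker (1 - B) A * kronecker n A"
        using symb by simp
      also have "\<dots> = kronecker (1 - B) A * kronecker ((1 - B) * n) A"
        by (simp only: kronecker_mult_left[OF A] mult.assoc)
      also have "kronecker ((1 - B) * n) A = kronecker 1 A"
      proof (rule kronecker_cong[OF A])
        have "(1 - B) * n - 1 = - B * A ^ k"
          using eq by (simp add: algebra_simps)
        thus "[(1 - B) * n = 1] (mod A)"
          using \<open>A dvd A ^ k\<close> by (simp add: cong_iff_dvd_diff)
      qed
      finally show ?thesis
        using symb A by (simp add: kronecker_one_left)
    qed
    moreover have "[B * A ^ k = 1] (mod n)"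
      unfolding cong_iff_dvd_diff eq [symmetric] by simp
    ultimately show ?thesis
      using k(1) n by blast
  qed
qed

text \<open>The exponent \<open>k + 2\<close> turns \<open>2 ^ k - 1 = (4 - B) * M * t\<close> into
  the quotient \<open>4 * M * t + 1\<close>. As \<open>2 ^ k - 1\<close> is odd, so is
  \<open>M * t\<close>, and the quotient is 5 modulo 8.\<close>

lemma order_dominant_two:
  assumes B: "odd B"
  shows "order_dominant 2 (of_int B)"
proof -
  have "order_dominant (of_int 2) (of_int B)"
  proof (rule order_dominantI)
    fix M :: int
    assume M: "M > 0" "coprime 2 M"
    hence "odd M" by simp
    have "odd (4 - B)"
      using B by simp
    hence pos: "\<bar>4 - B\<bar> * M > 0"
      using M by (intro mult_pos_pos) auto
    have "coprime 2 (\<bar>4 - B\<bar> * M)"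
      using \<open>odd M\<close> \<open>odd (4 - B)\<close> by simp
    then obtain k where k: "even k" "k > 0" "[2 ^ k = 1] (mod \<bar>4 - B\<bar> * M)"
      using even_power_cong_one[of 2 "\<bar>4 - B\<bar> * M" 1] pos by auto
    have "(4 - B) * M dvd 2 ^ k - 1"
    proof -
      have "\<bar>4 - B\<bar> * M dvd 2 ^ k - 1"
        using k(3) by (simp add: cong_iff_dvd_diff)
      moreover have "(4 - B) * M dvd \<bar>4 - B\<bar> * M"
        by (intro mult_dvd_mono) auto
      ultimately show ?thesis
        by (rule dvd_trans[rotated])
    qed
    then obtain t where t: "2 ^ k - 1 = (4 - B) * M * t" ..
    have "odd ((2 :: int) ^ k - 1)"
      using k(2) by simp
    hence "odd (M * t)"
      unfolding t by simp
    \<comment> \<open>For \<open>B > 4\<close> both \<open>t\<close> and \<open>n\<close> are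
      negative, hence the absolute values below; then \<open>- n\<close> is 3 modulo 8, where 2 also
      has symbol -1.\<close>
    define n where "n = 4 * (M * t) + 1"
    from \<open>odd (M * t)\<close> obtain u where "M * t = 2 * u + 1"
      by (blast elim: oddE)
    hence "n = 8 * u + 5"
      by (simp add: n_def)
    hence n8: "n mod 8 = 5"
      by presburger
    hence n: "odd \<bar>n\<bar>" "\<bar>n\<bar> > 0" "\<bar>n\<bar> mod 8 \<noteq> 1" "\<bar>n\<bar> mod 8 \<noteq> 7"
      by presburger+
    have eq: "(4 - B) * n = 2 ^ (k + 2) - B"
      using t by (simp add: n_def algebra_simps)
    have "coprime n M"
      by (rule coprime_of_dvd_diff_unit[of _ _ 1]) (simp_all add: n_def)
    hence "coprime \<bar>n\<bar> M"
      by simp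
    moreover have "kronecker 2 \<bar>n\<bar> = -1"
      using n by (simp add: kronecker_two)
    moreover have "[2 ^ (k + 2) = B] (mod \<bar>n\<bar>)"
      unfolding cong_iff_dvd_diff eq [symmetric] by simp
    moreover have "even (k + 2)"
      using k(1) by simp
    ultimately show "\<exists>k n. even k \<and> odd n \<and> n > 0 \<and> coprime n M \<and> kronecker 2 n = -1 \<and>
        ([2 ^ k = B] (mod n) \<or> [B * 2 ^ k = 1] (mod n))"
      using n(1,2) by blast
  qed
  thus ?thesis by simp
qed

text \<open>(-1/A) is -1 for \<open>A\<close> in the classes 3, 7 modulo 8 and (-2/A) for 5, 7,
  which leaves only the class 1.\<close>

lemma not_cong_one_mod_8_iff:
  assumes "odd A" "A > 0"
  shows "kronecker (-1) A = -1 \<or> kronecker (-2) A = -1 \<longleftrightarrow> \<not> [A = 1] (mod 8)"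
proof -
  have "kronecker (-2) A = kronecker (-1) A * kronecker 2 A"
    using kronecker_mult_left[OF assms, of "-1" 2] by simp
  moreover have "A mod 4 = (A mod 8) mod 4"
    by (simp add: mod_mod_cancel)
  moreover have "A mod 8 = 1 \<or> A mod 8 = 3 \<or> A mod 8 = 5 \<or> A mod 8 = 7"
    using assms(1) by presburger
  ultimately show ?thesis
    using assms by (auto simp: kronecker_minus_one kronecker_two cong_def)
qed

text \<open>For \<open>n\<close> congruent to -1 modulo \<open>8 * A\<close>, (A/n) = 1 and (-1/n) =
  -1. The exponent \<open>k + 4\<close> puts the factor \<open>A ^ 4\<close> into
  \<open>n + 1\<close>, and \<open>B > A ^ 4\<close> makes \<open>n\<close> positive.\<close>

lemma order_dominant_minus:
  assumes AB: "coprime A B" "A \<ge> 2" "B > A ^ 4"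
  shows "order_dominant (of_int (- A)) (of_int B)"
proof (rule order_dominantI)
  fix M :: int
  assume M: "M > 0" "coprime (- A) M"
  \<comment> \<open>For even \<open>A\<close> the power \<open>A ^ 4\<close> already contains
    \<open>8 * A\<close>, and \<open>L\<close> must stay odd to be coprime to \<open>A\<close>; for
    odd \<open>A\<close> the 8 comes from \<open>L\<close>.\<close>
  define L where "L = (if even A then M else 8 * M)"
  have "coprime A 8" if "odd A"
    using that coprime_power_right_iff[of A 2 3] by simp
  hence L: "L > 0" "coprime A L"
    using M by (auto simp: L_def)
  have "M dvd L"
    by (simp add: L_def)
  have "8 * A dvd A ^ 4 * L"
  proof (cases "even A")
    case True
    then obtain c where c: "A = 2 * c" ..
    have "A ^ 4 * L = 8 * A * (c ^ 3 * L)"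
      unfolding c by (simp add: power3_eq_cube power4_eq_xxxx)
    thus ?thesis by (rule dvdI)
  next
    case False
    hence "A ^ 4 * L = 8 * A * (A ^ 3 * M)"
      by (simp add: L_def power3_eq_cube power4_eq_xxxx)
    thus ?thesis by (rule dvdI)
  qed
  have "coprime A (B - A ^ 4)"
  proof (rule coprimeI)
    fix c assume c: "c dvd A" "c dvd B - A ^ 4"
    have "c dvd A ^ 4"
      using c(1) by (simp add: dvd_power_same dvd_trans[OF _ dvd_power])
    hence "c dvd B"
      using dvd_add[OF c(2)] by fastforce
    with AB(1) c(1) show "is_unit c"
      by (rule coprime_common_divisor)
  qed
  hence "coprime A ((B - A ^ 4) * L)"
    using L by simp
  moreover have pos: "(B - A ^ 4) * L > 0"
    using AB L by simp
  ultimately obtain k where k: "even k" "k > 0" "A ^ k > 1" "[A ^ k = 1] (mod (B - A ^ 4) * L)"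
    using even_power_cong_one[OF AB(2), of "(B - A ^ 4) * L" 1] by blast
  from k(4) obtain t where "A ^ k - 1 = (B - A ^ 4) * L * t"
    unfolding cong_iff_dvd_diff ..
  hence t: "A ^ k = 1 + (B - A ^ 4) * L * t"
    by linarith
  have "(B - A ^ 4) * L * t > 0"
    using k(3) t by simp
  with pos have "t > 0"
    by (rule zero_less_mult_pos[rotated])
  define n where "n = A ^ 4 * L * t - 1"
  have dvd: "8 * A dvd n + 1"
    using \<open>8 * A dvd A ^ 4 * L\<close> by (simp add: n_def)
  hence "8 dvd n + 1"
    by (rule dvd_mult_left)
  have "n + 1 > 0"
    using AB L \<open>t > 0\<close> by (simp add: n_def)
  hence n: "odd n" "n > 0" "n mod 4 = 3"
    using \<open>8 dvd n + 1\<close> by presburger+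
  have eq: "(B - A ^ 4) * n = A ^ (k + 4) - B"
    unfolding power_add t n_def by (simp add: algebra_simps)
  have "M dvd n + 1"
    using \<open>M dvd L\<close> by (simp add: n_def)
  hence "coprime n M"
    using coprime_of_dvd_diff_unit[of M n "-1"] by simp
  moreover have "kronecker A n = 1"
    using AB(2) n(2) dvd by (intro kronecker_eq_one_of_cong_minus_one) (auto simp: cong_iff_dvd_diff)
  hence "kronecker (- A) n = -1"
    using kronecker_mult_left[OF n(1,2), of "-1" A] n by (simp add: kronecker_minus_one)
  moreover have "[(- A) ^ (k + 4) = B] (mod n)"
  proof -
    have "(- A) ^ (k + 4) = A ^ (k + 4)"
      using k(1) by simp
    thus ?thesis
      unfolding cong_iff_dvd_diff by (simp only: eq [symmetric] dvd_triv_right)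
  qed
  moreover have "even (k + 4)"
    using k(1) by simp
  ultimately show "\<exists>k n. even k \<and> odd n \<and> n > 0 \<and> coprime n M \<and> kronecker (- A) n = -1 \<and>
      ([(- A) ^ k = B] (mod n) \<or> [B * (- A) ^ k = 1] (mod n))"
    using n(1,2) by blast
qed



theorem theorem1p1:
  shows
    "(\<forall>A B :: int. odd A \<and> A > 0 \<and> odd B \<and> B > 0 \<and>
        (kronecker (- B * (1 - B)) A = -1 \<or> kronecker (1 - B) A = -1) \<longrightarrow>
        order_dominant (of_int A) (of_int B)) \<and>
     (\<forall>B :: int. odd B \<and> B > 0 \<longrightarrow> order_dominant 2 (of_int B)) \<and>
     (\<forall>A :: int. odd A \<and> A > 0 \<longrightarrow>
        ((kronecker (-1) A = -1 \<or> kronecker (-2) A = -1) \<longleftrightarrow> \<not> [A = 1] (mod 8)) \<and>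
        ((kronecker (-1) A = -1 \<or> kronecker (-2) A = -1) \<longrightarrow> order_dominant (of_int A) 2)) \<and>
     (\<forall>A B :: int. coprime A B \<and> A \<ge> 2 \<and> B > A ^ 4 \<longrightarrow>
        order_dominant (of_int (- A)) (of_int B))"
proof (intro conjI allI impI; elim conjE)
  fix A B :: int
  assume A: "odd A" "A > 0" and B: "odd B" "B > 0"
    and symb: "kronecker (- B * (1 - B)) A = -1 \<or> kronecker (1 - B) A = -1"
  \<comment> \<open>For \<open>B = 1\<close> both symbols are (0/A), which is 0 or 1.\<close>
  have "B \<noteq> 1"
    using symb A kronecker_eq_0_iff[OF A, of 0] by auto
  with A B symb show "order_dominant (of_int A) (of_int B)"
    by (intro order_dominant_odd) auto
next
  fix A :: int
  assume A: "odd A" "A > 0"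
  assume symb: "kronecker (-1) A = -1 \<or> kronecker (-2) A = -1"
  have "kronecker (-2) A = kronecker (-1) A * kronecker 2 A"
    using kronecker_mult_left[OF A, of "-1" 2] by simp
  \<comment> \<open>If (-2/A) = -1, one of its factors (-1/A), (2/A) is -1, and these are the
    symbols of \<open>order_dominant_odd\<close> at \<open>B = 2\<close>.\<close>
  with symb have "kronecker 2 A = -1 \<or> kronecker (-1) A = -1"
    using kronecker_values[OF A, of "-1"] by auto
  with A have "order_dominant (of_int A) (of_int 2)"
    by (intro order_dominant_odd) auto
  thus "order_dominant (of_int A) 2"
    by simp
qed (use order_dominant_two not_cong_one_mod_8_iff order_dominant_minus in blast)+


end
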